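(* For every $m\in\mathbb{N}$ there exists $g_m\in\operatorname{Aut}(T_3)$, where $T_3$ is the $3$-regular tree, such that the $(P_2)$-closure $\langle g_m\rangle^{(P_2)}$ contains edge inversions of finite order, but does not contain an edge inversion of order less than $m$.
   Context: For a tree $T$ with vertex set $VT$ and graph distance $d$, put $B(v,n)=\{w\in VT \mid d(v,w)\le n\}$. An edge inversion is an automorphism of the tree that swaps the two endpoints of some edge. For $G\le\operatorname{Aut}(T)$, the $(P_k)$-closure of $G$ is $G^{(P_k)}=\{h\in\operatorname{Aut}(T)\mid \forall v\in VT\ \exists g\in G:\ h|_{B(v,k)}=g|_{B(v,k)}\}$. *)

theory Defs
  imports "HOL-Algebra.Bij" "HOL-Algebra.Generated_Groups" "HOL-Algebra.Multiplicative_Group"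
begin

text \<open>
  A graph is given by a vertex set \<open>V\<close> and a symmetric irreflexive adjacency relation \<open>E\<close>; each
  undirected edge appears in \<open>E\<close> in both orientations, so that \<open>(v, w) \<in> E ^^ n\<close> says that there is
  a walk of length \<open>n\<close> from \<open>v\<close> to \<open>w\<close>.
\<close>

definition simple_graph :: "'a set \<Rightarrow> ('a \<times> 'a) set \<Rightarrow> bool" where
  "simple_graph V E \<longleftrightarrow> E \<subseteq> V \<times> V \<and> sym E \<and> irrefl E"

definition graph_cycle :: "('a \<times> 'a) set \<Rightarrow> 'a list \<Rightarrow> bool" where
  "graph_cycle E p \<longleftrightarrow> length p \<ge> 3 \<and> distinct p \<and>
     (\<forall>i<length p. (p ! i, p ! (Suc i mod length p)) \<in> E)"

definition graph_tree :: "'a set \<Rightarrow> ('a \<times> 'a) set \<Rightarrow> bool" where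
  "graph_tree V E \<longleftrightarrow> simple_graph V E \<and> V \<noteq> {} \<and>
     (\<forall>v\<in>V. \<forall>w\<in>V. (v, w) \<in> E\<^sup>*) \<and> (\<nexists>p. graph_cycle E p)"

definition regular_tree :: "nat \<Rightarrow> 'a set \<Rightarrow> ('a \<times> 'a) set \<Rightarrow> bool" where
  "regular_tree d V E \<longleftrightarrow> graph_tree V E \<and> (\<forall>v\<in>V. finite {w. (v, w) \<in> E} \<and> card {w. (v, w) \<in> E} = d)"

definition graph_dist :: "('a \<times> 'a) set \<Rightarrow> 'a \<Rightarrow> 'a \<Rightarrow> nat" where
  "graph_dist E v w = (LEAST n. (v, w) \<in> E ^^ n)"

definition graph_ball :: "'a set \<Rightarrow> ('a \<times> 'a) set \<Rightarrow> 'a \<Rightarrow> nat \<Rightarrow> 'a set" where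
  "graph_ball V E v n = {w \<in> V. graph_dist E v w \<le> n}"

text \<open>
  As in \<^const>\<open>BijGroup\<close>, automorphisms are functions on \<open>V\<close> extended by \<^const>\<open>undefined\<close>
  outside \<open>V\<close>, so that each automorphism is represented by exactly one function.
\<close>

definition graph_auts :: "'a set \<Rightarrow> ('a \<times> 'a) set \<Rightarrow> ('a \<Rightarrow> 'a) set" where
  "graph_auts V E = {f \<in> Bij V. \<forall>v\<in>V. \<forall>w\<in>V. (f v, f w) \<in> E \<longleftrightarrow> (v, w) \<in> E}"

definition Aut_graph :: "'a set \<Rightarrow> ('a \<times> 'a) set \<Rightarrow> ('a \<Rightarrow> 'a) monoid" where
  "Aut_graph V E = BijGroup V \<lparr>carrier := graph_auts V E\<rparr>"

definition edge_inversion :: "'a set \<Rightarrow> ('a \<times> 'a) set \<Rightarrow> ('a \<Rightarrow> 'a) \<Rightarrow> bool" where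
  "edge_inversion V E h \<longleftrightarrow> h \<in> carrier (Aut_graph V E) \<and> (\<exists>(v, w)\<in>E. h v = w \<and> h w = v)"

definition P_closure :: "'a set \<Rightarrow> ('a \<times> 'a) set \<Rightarrow> nat \<Rightarrow> ('a \<Rightarrow> 'a) set \<Rightarrow> ('a \<Rightarrow> 'a) set" where
  "P_closure V E k G = {h \<in> carrier (Aut_graph V E).
     \<forall>v\<in>V. \<exists>g\<in>G. restrict h (graph_ball V E v k) = restrict g (graph_ball V E v k)}"

lemma group_Aut_graph: "group (Aut_graph V E)"
proof -
  have "subgroup (graph_auts V E) (BijGroup V)"
  proof (rule subgroup.intro)
    show "graph_auts V E \<subseteq> carrier (BijGroup V)"
      by (auto simp: graph_auts_def BijGroup_def)
    show "\<one>\<^bsub>BijGroup V\<^esub> \<in> graph_auts V E"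
      by (simp add: graph_auts_def BijGroup_def id_Bij)
  next
    fix x y assume "x \<in> graph_auts V E" "y \<in> graph_auts V E"
    moreover from this have "y v \<in> V" if "v \<in> V" for v
      using that by (auto simp: graph_auts_def dest: Bij_imp_funcset)
    ultimately show "x \<otimes>\<^bsub>BijGroup V\<^esub> y \<in> graph_auts V E"
      by (simp add: graph_auts_def BijGroup_def compose_Bij compose_eq)
  next
    fix x assume x: "x \<in> graph_auts V E"
    then have xB: "x \<in> Bij V" and E: "\<And>v w. v \<in> V \<Longrightarrow> w \<in> V \<Longrightarrow> (x v, x w) \<in> E \<longleftrightarrow> (v, w) \<in> E"
      by (auto simp: graph_auts_def)
    have r: "x (inv_into V x v) = v" if "v \<in> V" for v
      using xB that by (auto simp: Bij_def bij_betw_def intro: f_inv_into_f)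
    show "inv\<^bsub>BijGroup V\<^esub> x \<in> graph_auts V E"
      using E[OF Bij_inv_into_mem[OF xB] Bij_inv_into_mem[OF xB]]
      by (auto simp: inv_BijGroup[OF xB] graph_auts_def restrict_inv_into_Bij[OF xB] r)
  qed
  then show ?thesis
    unfolding Aut_graph_def by (rule subgroup.subgroup_is_group[OF _ group_BijGroup])
qed

text \<open>The 3-regular tree exists: reduced words over a three-letter alphabet.\<close>

lemma regular_tree_3_exists: "\<exists>(V :: nat list set) E. regular_tree 3 V E"
proof -
  define V :: "nat list set" where "V = {xs. set xs \<subseteq> {0, 1, 2} \<and> distinct_adj xs}"
  define E where "E = {(xs, ys). xs \<in> V \<and> ys \<in> V \<and> (xs \<noteq> [] \<and> ys = tl xs \<or> ys \<noteq> [] \<and> xs = tl ys)}"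
  have V_tl: "xs \<in> V" if "a # xs \<in> V" for a xs
    using that by (cases xs) (auto simp: V_def)
  have sg: "simple_graph V E"
    unfolding simple_graph_def
  proof (intro conjI)
    show "irrefl E"
      by (rule irreflI) (auto simp: E_def neq_Nil_conv)
  qed (auto simp: E_def sym_def)
  have root: "(xs, []) \<in> E\<^sup>*" if "xs \<in> V" for xs
    using that
  proof (induction xs)
    case (Cons a xs)
    then have "(a # xs, xs) \<in> E"
      using V_tl by (auto simp: E_def)
    with Cons V_tl show ?case by (meson converse_rtrancl_into_rtrancl)
  qed simp
  have symE: "sym (E\<^sup>*)"
    using sg by (simp add: simple_graph_def sym_rtrancl)
  have conn: "(v, w) \<in> E\<^sup>*" if "v \<in> V" "w \<in> V" for v w
    using root[OF that(1)] root[OF that(2)] symE by (meson rtrancl_trans symD)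
  have acyc: False if p: "graph_cycle E p" for p
  proof -
    let ?n = "length p"
    from p have n: "?n \<ge> 3" and d: "distinct p"
      and e: "\<And>i. i < ?n \<Longrightarrow> (p ! i, p ! (Suc i mod ?n)) \<in> E"
      by (auto simp: graph_cycle_def)
    define M where "M = Max (length ` set p)"
    have "M \<in> length ` set p" unfolding M_def using n by (intro Max_in) auto
    then obtain i where i: "i < ?n" "length (p ! i) = M"
      by (auto simp: in_set_conv_nth)
    have le: "length (p ! j) \<le> length (p ! i)" if "j < ?n" for j
      unfolding i(2) M_def using that by (intro Max_ge) auto
    define j where "j = Suc i mod ?n"
    define k where "k = (if i = 0 then ?n - 1 else i - 1)"
    have jk: "j < ?n" "k < ?n" "Suc k mod ?n = i" "j \<noteq> k"
      using n i(1) by (auto simp: j_def k_def mod_Suc)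
    have "(p ! i, p ! j) \<in> E" using e[OF i(1)] by (simp add: j_def)
    moreover have "(p ! k, p ! i) \<in> E" using e[OF jk(2)] jk(3) by simp
    ultimately have "p ! j = tl (p ! i)" "p ! k = tl (p ! i)"
      using le[OF jk(1)] le[OF jk(2)]
      by (auto simp: E_def neq_Nil_conv)
    with d jk show False by (metis nth_eq_iff_index_eq)
  qed
  have nb: "finite {w. (v, w) \<in> E} \<and> card {w. (v, w) \<in> E} = 3" if v: "v \<in> V" for v
  proof (cases v)
    case Nil
    have "{w. (v, w) \<in> E} = {[0], [1], [2]}"
      by (auto simp: Nil E_def V_def neq_Nil_conv)
    then show ?thesis by simp
  next
    case (Cons x xs)
    have *: "{w. (v, w) \<in> E} = insert xs ((\<lambda>y. y # v) ` ({0, 1, 2} - {x}))"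
    proof -
      have xs: "xs \<in> V" using v V_tl unfolding Cons by blast
      have V_v: "y # v \<in> V \<longleftrightarrow> y \<in> {0, 1, 2} - {x}" for y
        using v by (auto simp: Cons V_def)
      have "(v, w) \<in> E \<longleftrightarrow> w = xs \<or> (\<exists>y. w = y # v \<and> y # v \<in> V)" for w
        using v xs by (cases w) (auto simp: Cons E_def)
      then show ?thesis unfolding V_v by blast
    qed
    have "x \<in> {0, 1, 2}" using v by (auto simp: Cons V_def)
    then obtain y z where yz: "{0, 1, 2} - {x} = {y, z}" "y \<noteq> z"
    proof -
      assume t: "\<And>y z. {0, 1, 2} - {x} = {y, z} \<Longrightarrow> y \<noteq> z \<Longrightarrow> thesis"
      assume "x \<in> {0, 1, 2}"
      then consider "x = 0" | "x = 1" | "x = 2" by auto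
      then show thesis
      proof cases
        case 1 then show thesis by (intro t[of 1 2]) auto
      next
        case 2 then show thesis by (intro t[of 0 2]) auto
      next
        case 3 then show thesis by (intro t[of 0 1]) auto
      qed
    qed
    have "xs \<noteq> y # v" "xs \<noteq> z # v"
      unfolding Cons by (auto dest: arg_cong[where f = length])
    with yz(2) show ?thesis unfolding * yz(1) by simp
  qed
  have "[] \<in> V" by (simp add: V_def)
  then have "regular_tree 3 V E"
    using sg conn acyc nb unfolding regular_tree_def graph_tree_def by blast
  then show ?thesis by blast
qed

end

theory Submission
  imports Defs "HOL-Number_Theory.Cong"
begin

text \<open>
  Root the tree at the midpoint of an edge and identify the \<open>2 ^ (n + 1)\<close> vertices at distance \<open>n\<close>
  from that edge with the residues modulo \<open>2 ^ (n + 1)\<close>, the parent map being reduction. Let \<open>g\<close> add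
  \<open>1\<close> on the levels \<open>n < N\<close> and move the deeper subtrees rigidly, so that \<open>g\<close> inverts the root edge and
  has order \<open>2 ^ N\<close>. If \<open>h\<close> is an inversion in the closure, it agrees near the vertex \<open>x\<close> of level
  \<open>n\<close> with \<open>g\<close> to the power \<open>K n x\<close>, where \<open>K 0 0\<close> is odd. Balls around a vertex and its parent overlap
  in the children of the vertex, so \<open>K\<close> changes only by a multiple of \<open>2 ^ (n + 3)\<close> from level \<open>n\<close> to
  level \<open>n + 1\<close>. Inductively the sum of \<open>K n\<close> over level \<open>n\<close> is an odd multiple of \<open>2 ^ (n + 1)\<close>. This sum is the
  displacement on level \<open>n + 1\<close> after \<open>h\<close> has run once through level \<open>n\<close>, hence \<open>h\<close> is transitive
  on each of these levels.
\<close>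

section \<open>Shifts of the levels by varying exponents, modulo powers of two\<close>

definition shift_at :: "(nat \<Rightarrow> int \<Rightarrow> int) \<Rightarrow> nat \<Rightarrow> int \<Rightarrow> int" where
  "shift_at K n x = (x + K n x) mod 2 ^ Suc n"

lemma shift_at_funpow_range:
  "x \<in> {0..<2 ^ Suc n} \<Longrightarrow> (shift_at K n ^^ i) x \<in> {0..<2 ^ Suc n}"
  by (induction i) (auto simp: shift_at_def)

text \<open>On level \<open>0\<close> two odd numbers congruent modulo \<open>4\<close> add up to
  \<open>2\<close> modulo \<open>4\<close>. On level \<open>Suc n\<close> both \<open>x\<close> and
  \<open>x + 2 ^ Suc n\<close> lie over \<open>x\<close> and by \<open>step\<close> have its
  exponent up to \<open>2 ^ (n + 3)\<close>, so the sum doubles from level to level.\<close>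

lemma sum_exponents:
  fixes K :: "nat \<Rightarrow> int \<Rightarrow> int"
  assumes odd: "odd (K 0 0)" and base: "[K 0 1 = K 0 0] (mod 4)"
    and step: "\<And>n y. n < m \<Longrightarrow> y \<in> {0..<2 ^ Suc (Suc n)} \<Longrightarrow>
      [K (Suc n) y = K n (y mod 2 ^ Suc n)] (mod 2 ^ (n + 3))"
    and "n \<le> m"
  shows "[(\<Sum>x\<in>{0..<2 ^ Suc n}. K n x) = 2 ^ Suc n] (mod 2 ^ Suc (Suc n))"
  using \<open>n \<le> m\<close>
proof (induction n)
  case 0
  have "{0..<2::int} = {0, 1}" by auto
  then have "(\<Sum>x\<in>{0..<2 ^ Suc 0}. K 0 x) = K 0 0 + K 0 1" by simp
  moreover obtain j where "K 0 0 = 2 * j + 1" using odd by (auto elim: oddE)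
  moreover obtain t where "K 0 1 = K 0 0 + 4 * t"
    using base by (metis cong_iff_lin cong_sym)
  ultimately have "(\<Sum>x\<in>{0..<2 ^ Suc 0}. K 0 x) - 2 = 4 * (j + t)" by simp
  then show ?case by (simp add: cong_iff_dvd_diff)
next
  case (Suc n)
  let ?D = "2 ^ Suc n :: int"
  have split: "{0..<2 ^ Suc (Suc n)} = {0..<?D} \<union> (\<lambda>x. x + ?D) ` {0..<?D}"
    by (subst image_add_atLeastLessThan') auto
  have disj: "{0..<?D} \<inter> (\<lambda>x. x + ?D) ` {0..<?D} = {}" by auto
  have "(\<Sum>x\<in>{0..<2 ^ Suc (Suc n)}. K (Suc n) x)
      = (\<Sum>x\<in>{0..<?D}. K (Suc n) x) + (\<Sum>x\<in>(\<lambda>x. x + ?D) ` {0..<?D}. K (Suc n) x)"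
    unfolding split by (rule sum.union_disjoint) (use disj in auto)
  also have "(\<Sum>x\<in>(\<lambda>x. x + ?D) ` {0..<?D}. K (Suc n) x) = (\<Sum>x\<in>{0..<?D}. K (Suc n) (x + ?D))"
    by (subst sum.reindex) (auto simp: inj_on_def)
  finally have *: "(\<Sum>x\<in>{0..<2 ^ Suc (Suc n)}. K (Suc n) x)
      = (\<Sum>x\<in>{0..<?D}. K (Suc n) x) + (\<Sum>x\<in>{0..<?D}. K (Suc n) (x + ?D))" .
  have "[(\<Sum>x\<in>{0..<?D}. K (Suc n) x) = (\<Sum>x\<in>{0..<?D}. K n x)] (mod 2 ^ (n + 3))"
  proof (rule cong_sum)
    fix x assume "x \<in> {0..<?D}"
    then show "[K (Suc n) x = K n x] (mod 2 ^ (n + 3))"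
      using step[of n x] Suc.prems by auto
  qed
  moreover have "[(\<Sum>x\<in>{0..<?D}. K (Suc n) (x + ?D)) = (\<Sum>x\<in>{0..<?D}. K n x)] (mod 2 ^ (n + 3))"
  proof (rule cong_sum)
    fix x assume x: "x \<in> {0..<?D}"
    then have "(x + ?D) mod ?D = x" by (metis mod_add_self2 mod_pos_pos_trivial atLeastLessThan_iff)
    then show "[K (Suc n) (x + ?D) = K n x] (mod 2 ^ (n + 3))"
      using step[of n "x + ?D"] Suc.prems x by auto
  qed
  ultimately have "[(\<Sum>x\<in>{0..<2 ^ Suc (Suc n)}. K (Suc n) x) = 2 * (\<Sum>x\<in>{0..<?D}. K n x)] (mod 2 ^ (n + 3))"
    unfolding * mult_2 by (rule cong_add)
  \<comment> \<open>Doubling the induction hypothesis doubles its modulus too, which matches the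
    modulus of \<open>step\<close>.\<close>
  moreover have "[2 * (\<Sum>x\<in>{0..<?D}. K n x) = 2 * 2 ^ Suc n] (mod 2 * 2 ^ Suc (Suc n))"
    using Suc by (intro cong_cmult_leftI) auto
  ultimately show ?case
    by (metis (no_types, lifting) cong_trans power_Suc add_Suc_right numeral_3_eq_3 add_0_right)
qed

text \<open>Induction on the level. If every orbit on level \<open>n\<close> is the whole level, one
  turn through it moves a point of level \<open>Suc n\<close> by the sum of all exponents, which is
  half of the modulus. Hence the point comes back only after an even number of turns.\<close>

lemma shift_at_period:
  fixes K :: "nat \<Rightarrow> int \<Rightarrow> int"
  assumes odd: "odd (K 0 0)" and base: "[K 0 1 = K 0 0] (mod 4)"
    and step: "\<And>n y. n < m \<Longrightarrow> y \<in> {0..<2 ^ Suc (Suc n)} \<Longrightarrow>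
      [K (Suc n) y = K n (y mod 2 ^ Suc n)] (mod 2 ^ (n + 3))"
    and "n \<le> m" "x \<in> {0..<2 ^ Suc n}" "(shift_at K n ^^ i) x = x"
  shows "2 ^ Suc n dvd i"
  using assms(4-6)
proof (induction n arbitrary: x i)
  case 0
  have "[K 0 1 = K 0 0] (mod 2)" by (rule cong_dvd_modulus[OF base]) simp
  then have odd1: "odd (K 0 1)" using odd by (simp add: cong_dvd_iff)
  have two: "y \<in> {0, 1}" if "y \<in> {0..<2 ^ Suc 0}" for y :: int using that by auto
  \<comment> \<open>Both exponents on level \<open>0\<close> are odd, so each iteration flips the
    parity.\<close>
  have "even ((shift_at K 0 ^^ i) x - x - int i)"
  proof (induction i)
    case (Suc i)
    define y where "y = (shift_at K 0 ^^ i) x"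
    have "y \<in> {0, 1}" unfolding y_def by (intro two shift_at_funpow_range 0)
    then have "odd (K 0 y)" using odd odd1 by auto
    then have "odd (shift_at K 0 y - y)" by (auto simp: shift_at_def even_mod_2_iff)
    then show ?case using Suc by (auto simp flip: y_def)
  qed simp
  then show ?case using 0 by simp
next
  case (Suc n)
  let ?D = "2 ^ Suc n :: int"
  let ?f = "shift_at K (Suc n)" and ?e = "shift_at K n"
  note x = Suc.prems(2)
  have dvd: "?D dvd 2 ^ Suc (Suc n)" by simp
  have K: "[K (Suc n) y = K n (y mod ?D)] (mod 2 ^ Suc (Suc n))" if "y \<in> {0..<2 ^ Suc (Suc n)}" for y
    by (rule cong_dvd_modulus[OF step]) (use Suc.prems that in \<open>auto simp: power_add\<close>)
  \<comment> \<open>Reduction modulo \<open>2 ^ Suc n\<close> carries orbits of level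
    \<open>Suc n\<close> to orbits of level \<open>n\<close>, so the exponents summed in
    \<open>acc\<close> can be read off on level \<open>n\<close>.\<close>
  have proj: "(?f ^^ j) y mod ?D = (?e ^^ j) (y mod ?D)" if y: "y \<in> {0..<2 ^ Suc (Suc n)}" for y j
  proof (induction j)
    case (Suc j)
    let ?z = "(?f ^^ j) y"
    have z: "?z \<in> {0..<2 ^ Suc (Suc n)}" by (rule shift_at_funpow_range[OF y])
    have "(?f ^^ Suc j) y mod ?D = (?z + K (Suc n) ?z) mod ?D"
      by (simp add: shift_at_def mod_mod_cancel)
    also have "\<dots> = (?z mod ?D + K n (?z mod ?D)) mod ?D"
      using cong_dvd_modulus[OF K[OF z] dvd] unfolding cong_def by (metis mod_add_eq mod_mod_trivial)
    also have "\<dots> = ?e (?z mod ?D)" by (simp only: shift_at_def)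
    finally show ?case using Suc by simp
  qed simp
  have acc: "[(?f ^^ j) y = y + (\<Sum>l<j. K n ((?e ^^ l) (y mod ?D)))] (mod 2 ^ Suc (Suc n))"
    if y: "y \<in> {0..<2 ^ Suc (Suc n)}" for y j
  proof (induction j)
    case (Suc j)
    let ?z = "(?f ^^ j) y"
    have z: "?z \<in> {0..<2 ^ Suc (Suc n)}" by (rule shift_at_funpow_range[OF y])
    have "[(?f ^^ Suc j) y = ?z + K (Suc n) ?z] (mod 2 ^ Suc (Suc n))"
      by (simp add: shift_at_def)
    also have "[?z + K (Suc n) ?z = (y + (\<Sum>l<j. K n ((?e ^^ l) (y mod ?D)))) + K n (?z mod ?D)] (mod 2 ^ Suc (Suc n))"
      by (rule cong_add[OF Suc K[OF z]])
    finally show ?case by (simp only: proj[OF y] sum.lessThan_Suc add.assoc)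
  qed simp
  \<comment> \<open>By the induction hypothesis equal iterates are a multiple of
    \<open>2 ^ Suc n\<close> steps apart, so the first \<open>2 ^ Suc n\<close> of them are distinct
    and, by counting, fill the level.\<close>
  have inj: "inj_on (\<lambda>l. (?e ^^ l) z) {..<2 ^ Suc n}" if z: "z \<in> {0..<?D}" for z
  proof (rule linorder_inj_onI)
    fix a b :: nat assume ab: "a < b" "a \<in> {..<2 ^ Suc n}" "b \<in> {..<2 ^ Suc n}"
    show "(?e ^^ a) z \<noteq> (?e ^^ b) z"
    proof
      assume eq: "(?e ^^ a) z = (?e ^^ b) z"
      have "(?e ^^ (b - a)) ((?e ^^ a) z) = (?e ^^ (b - a + a)) z"
        unfolding funpow_add by simp
      also have "\<dots> = (?e ^^ a) z" using ab eq by simp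
      finally have "2 ^ Suc n dvd b - a"
        using Suc.IH[of "(?e ^^ a) z" "b - a"] Suc.prems shift_at_funpow_range[OF z] by auto
      then show False using ab by (auto dest: dvd_imp_le)
    qed
  qed auto
  have img: "(\<lambda>l. (?e ^^ l) z) ` {..<2 ^ Suc n} = {0..<?D}" if z: "z \<in> {0..<?D}" for z
  proof (rule card_subset_eq)
    show "(\<lambda>l. (?e ^^ l) z) ` {..<2 ^ Suc n} \<subseteq> {0..<?D}"
      using shift_at_funpow_range[OF z] by blast
    show "card ((\<lambda>l. (?e ^^ l) z) ` {..<2 ^ Suc n}) = card {0..<?D}"
      by (subst card_image[OF inj[OF z]]) (simp add: nat_power_eq nat_mult_distrib)
  qed simp
  have turn: "[(?f ^^ 2 ^ Suc n) y = y + ?D] (mod 2 ^ Suc (Suc n))" if y: "y \<in> {0..<2 ^ Suc (Suc n)}" for y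
  proof -
    have z: "y mod ?D \<in> {0..<?D}" by simp
    have "(\<Sum>l<2 ^ Suc n. K n ((?e ^^ l) (y mod ?D))) = (\<Sum>x\<in>{0..<?D}. K n x)"
      using sum.reindex[OF inj[OF z], of "K n"] unfolding img[OF z] by (simp add: o_def)
    then show ?thesis
      using cong_trans[OF acc[OF y, of "2 ^ Suc n"]] sum_exponents[OF odd base step, of m n] Suc.prems
      by (simp add: cong_add_lcancel)
  qed
  have turns: "[(?f ^^ (2 ^ Suc n * q)) x = x + ?D * int q] (mod 2 ^ Suc (Suc n))" for q
  proof (induction q)
    case (Suc q)
    let ?z = "(?f ^^ (2 ^ Suc n * q)) x"
    have z: "?z \<in> {0..<2 ^ Suc (Suc n)}" by (rule shift_at_funpow_range[OF x])
    have "(?f ^^ (2 ^ Suc n * Suc q)) x = (?f ^^ 2 ^ Suc n) ?z"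
      by (simp only: mult_Suc_right funpow_add o_apply)
    then have "[(?f ^^ (2 ^ Suc n * Suc q)) x = ?z + ?D] (mod 2 ^ Suc (Suc n))"
      using turn[OF z] by simp
    also have "[?z + ?D = (x + ?D * int q) + ?D] (mod 2 ^ Suc (Suc n))"
      by (rule cong_add[OF Suc cong_refl])
    finally show ?case by (simp add: algebra_simps)
  qed simp
  \<comment> \<open>Projecting to level \<open>n\<close> shows that \<open>i\<close> consists of
    \<open>q\<close> full turns. They displace \<open>x\<close> by \<open>q\<close> times half of
    the modulus, so \<open>q\<close> is even.\<close>
  have "2 ^ Suc n dvd i"
    using Suc.IH[of "x mod ?D" i] proj[OF Suc.prems(2), of i] Suc.prems by simp
  then obtain q where q: "i = 2 ^ Suc n * q" ..
  have "[x + 0 = x + ?D * int q] (mod 2 ^ Suc (Suc n))"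
    using turns[of q] Suc.prems(3) unfolding q by simp
  then have "2 ^ Suc (Suc n) dvd ?D * int q"
    unfolding cong_add_lcancel by (metis cong_0_iff cong_sym)
  then have "4 dvd 2 * int q" by simp
  then have "even q" by presburger
  then show ?case unfolding q by auto
qed

section \<open>Walks in trees and local isomorphisms onto trees\<close>

text \<open>A repetition with the least gap \<open>d\<close> encloses a cycle: \<open>d\<close> is
  not \<open>1\<close> by irreflexivity and not \<open>2\<close> since the walk never turns back,
  and minimality makes the vertices in between distinct.\<close>

lemma nonbacktracking_walk_inj:
  assumes tree: "graph_tree V E"
    and edge: "\<And>i. i < n \<Longrightarrow> (p i, p (Suc i)) \<in> E"
    and nb: "\<And>i. Suc i < n \<Longrightarrow> p i \<noteq> p (Suc (Suc i))"
  shows "inj_on p {..n}"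
proof (rule ccontr)
  have irr: "irrefl E" and acyc: "\<nexists>c. graph_cycle E c"
    using tree by (auto simp: graph_tree_def simple_graph_def)
  let ?R = "\<lambda>d. \<exists>i. 0 < d \<and> i + d \<le> n \<and> p i = p (i + d)"
  assume "\<not> inj_on p {..n}"
  then obtain i j where "i < j" "j \<le> n" "p i = p j"
    by (meson linorder_inj_onI atMost_iff nat_le_linear)
  then have "?R (j - i)" by (intro exI[of _ i]) auto
  define d where "d = (LEAST d. ?R d)"
  have "?R d" unfolding d_def by (rule LeastI[of ?R, OF \<open>?R (j - i)\<close>])
  then obtain i where i: "0 < d" "i + d \<le> n" "p i = p (i + d)" by blast
  have least: "d \<le> e" if "?R e" for e unfolding d_def by (rule Least_le[of ?R, OF that])
  have "d \<noteq> 1" using edge[of i] irr i by (auto simp: irrefl_def)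
  moreover have "d \<noteq> 2" using nb[of i] i by (auto simp: numeral_2_eq_2)
  ultimately have "d \<ge> 3" using i(1) by linarith
  let ?c = "map p [i..<i + d]"
  have "distinct ?c"
  proof (subst distinct_map, intro conjI linorder_inj_onI)
    fix a b assume ab: "a < b" "a \<in> set [i..<i + d]" "b \<in> set [i..<i + d]"
    show "p a \<noteq> p b"
    proof
      assume "p a = p b"
      then have "?R (b - a)" using ab i by (intro exI[of _ a]) auto
      from least[OF this] ab show False by auto
    qed
  qed auto
  moreover have "(?c ! k, ?c ! (Suc k mod length ?c)) \<in> E" if "k < length ?c" for k
  \<comment> \<open>At the wrap-around the next vertex is \<open>p i\<close>, which equals
    \<open>p (i + d)\<close>, so the closing edge is the last edge of the segment.\<close>
  proof (cases "Suc k = d")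
    case True
    have "?c ! (Suc k mod length ?c) = p i" using True i(1) by simp
    also have "\<dots> = p (Suc (i + k))" using i(3) by (simp flip: True)
    finally have "?c ! (Suc k mod length ?c) = p (Suc (i + k))" .
    then show ?thesis using edge[of "i + k"] that i(2) by simp
  next
    case False
    then show ?thesis using edge[of "i + k"] that i(2) by simp
  qed
  ultimately have "graph_cycle E ?c" using \<open>d \<ge> 3\<close> unfolding graph_cycle_def by simp
  then show False using acyc by blast
qed

text \<open>The image of a shortest walk does not turn back, so in a tree it is closed only if it is
  trivial, and \<open>f\<close> is injective. It is onto since walks in the tree can be lifted edge
  by edge. The coordinate graph is thus identified with the tree without a separate proof that it
  has no cycles.\<close>

lemma local_isomorphism_onto_tree:
  assumes tree: "graph_tree V E"
    and conn: "\<And>a b. a \<in> A \<Longrightarrow> b \<in> A \<Longrightarrow> (a, b) \<in> R\<^sup>*" and sub: "R \<subseteq> A \<times> A" and symR: "sym R" and "A \<noteq> {}"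
    and maps: "\<And>a. a \<in> A \<Longrightarrow> f a \<in> V"
    and loc: "\<And>a. a \<in> A \<Longrightarrow> bij_betw f {b. (a, b) \<in> R} {w. (f a, w) \<in> E}"
  shows "bij_betw f A V" and "\<And>a b. a \<in> A \<Longrightarrow> b \<in> A \<Longrightarrow> (f a, f b) \<in> E \<longleftrightarrow> (a, b) \<in> R"
proof -
  have hom: "(f a, f b) \<in> E" if "(a, b) \<in> R" for a b
    using loc[of a] that sub by (auto simp: bij_betw_def)
  have inj: "inj_on f A"
  proof (rule inj_onI)
    fix a b assume ab: "a \<in> A" "b \<in> A" "f a = f b"
    obtain k where "(a, b) \<in> R ^^ k" using conn[OF ab(1,2)] by (auto simp: rtrancl_power)
    define n where "n = (LEAST n. (a, b) \<in> R ^^ n)"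
    have "(a, b) \<in> R ^^ n" unfolding n_def by (rule LeastI[of "\<lambda>n. (a, b) \<in> R ^^ n", OF \<open>(a, b) \<in> R ^^ k\<close>])
    then obtain p where p: "p 0 = a" "p n = b" "\<And>i. i < n \<Longrightarrow> (p i, p (Suc i)) \<in> R"
      by (auto simp: relpow_fun_conv)
    have "inj_on (f \<circ> p) {..n}"
    proof (rule nonbacktracking_walk_inj[OF tree])
      fix i assume i: "Suc i < n"
      \<comment> \<open>If the image turned back, injectivity of \<open>f\<close> around the middle
        vertex would make \<open>p\<close> turn back, and leaving out these two edges would give a
        walk shorter than \<open>n\<close>.\<close>
      show "(f \<circ> p) i \<noteq> (f \<circ> p) (Suc (Suc i))"
      proof
        assume eq: "(f \<circ> p) i = (f \<circ> p) (Suc (Suc i))"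
        have A: "p (Suc i) \<in> A" using p(3)[OF i] sub by auto
        have e: "(p i, p (Suc i)) \<in> R" "(p (Suc i), p (Suc (Suc i))) \<in> R" using p(3) i by auto
        have "inj_on f {b. (p (Suc i), b) \<in> R}" using loc[OF A] by (simp add: bij_betw_def)
        then have return: "p i = p (Suc (Suc i))"
          using eq e symD[OF symR] by (auto dest!: inj_onD)
        have "(a, p i) \<in> R ^^ i"
          unfolding relpow_fun_conv using p i by (intro exI[of _ p]) auto
        moreover obtain r where r: "n = Suc (Suc i) + r" using i less_iff_Suc_add by auto
        have "(p (Suc (Suc i)), b) \<in> R ^^ r"
          unfolding relpow_fun_conv using p r by (intro exI[of _ "\<lambda>l. p (Suc (Suc i) + l)"]) auto
        ultimately have "(a, b) \<in> R ^^ (i + r)"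
          unfolding relpow_add using return by auto
        then have "n \<le> i + r" unfolding n_def by (rule Least_le)
        then show False using r by simp
      qed
    qed (use p hom in auto)
    then have "n = 0" using ab(3) p(1,2) by (auto simp: inj_on_def)
    then show "a = b" using p by simp
  qed
  obtain a0 where a0: "a0 \<in> A" using \<open>A \<noteq> {}\<close> by blast
  have "v \<in> f ` A" if "v \<in> V" for v
  proof -
    have "(f a0, v) \<in> E\<^sup>*" using tree that maps[OF a0] by (auto simp: graph_tree_def)
    then show ?thesis
    proof induction
      case (step u w)
      then obtain a where a: "a \<in> A" "u = f a" by blast
      then have "w \<in> f ` {b. (a, b) \<in> R}" using loc[of a] step by (auto simp: bij_betw_def)
      then show ?case using sub by auto
    qed (use a0 in simp)
  qed
  then show "bij_betw f A V" using inj maps by (auto simp: bij_betw_def)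
  show "(f a, f b) \<in> E \<longleftrightarrow> (a, b) \<in> R" if "a \<in> A" "b \<in> A" for a b
  proof
    assume "(f a, f b) \<in> E"
    then have "f b \<in> f ` {c. (a, c) \<in> R}" using loc[OF that(1)] by (simp add: bij_betw_def)
    then obtain c where "(a, c) \<in> R" "f c = f b" by auto
    then show "(a, b) \<in> R" using inj that sub by (auto dest: inj_onD)
  qed (rule hom)
qed

section \<open>Binary coordinates on the 3-regular tree\<close>

definition coords :: "(nat \<times> int) set" where
  "coords = {(n, x). x \<in> {0..<2 ^ Suc n}}"

text \<open>The endpoints of the root edge are each other's parents, so that every edge joins a vertex to
  its parent.\<close>

fun parent :: "nat \<times> int \<Rightarrow> nat \<times> int" where
  "parent (0, x) = (0, 1 - x)"
| "parent (Suc n, y) = (n, y mod 2 ^ Suc n)"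

definition coord_edges :: "((nat \<times> int) \<times> (nat \<times> int)) set" where
  "coord_edges = {(a, b). a \<in> coords \<and> b \<in> coords \<and> (b = parent a \<or> a = parent b)}"

lemma parent_in_coords: "a \<in> coords \<Longrightarrow> parent a \<in> coords"
  by (cases a rule: parent.cases) (auto simp: coords_def)

lemma sym_coord_edges: "sym coord_edges"
  by (auto simp: coord_edges_def sym_def)

lemma coord_edges_connected:
  assumes "a \<in> coords" "b \<in> coords"
  shows "(a, b) \<in> coord_edges\<^sup>*"
proof -
  have root: "((n, x), (0, 0)) \<in> coord_edges\<^sup>*" if "(n, x) \<in> coords" for n x
    using that
  proof (induction n arbitrary: x)
    case 0
    then have "x = 0 \<or> x = 1" by (auto simp: coords_def)
    moreover have "((0, 1), (0, 0)) \<in> coord_edges" by (auto simp: coord_edges_def coords_def)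
    ultimately show ?case by auto
  next
    case (Suc n)
    have "((Suc n, x), (n, x mod 2 ^ Suc n)) \<in> coord_edges"
      using Suc.prems parent_in_coords[OF Suc.prems] by (auto simp: coord_edges_def)
    moreover have "((n, x mod 2 ^ Suc n), (0, 0)) \<in> coord_edges\<^sup>*"
      using parent_in_coords[OF Suc.prems] by (intro Suc.IH) simp
    ultimately show ?case by (rule converse_rtrancl_into_rtrancl)
  qed
  have "sym (coord_edges\<^sup>*)" by (rule sym_rtrancl[OF sym_coord_edges])
  then show ?thesis using root[of "fst a" "snd a"] root[of "fst b" "snd b"] assms
    by (simp, meson rtrancl_trans symD)
qed

text \<open>The quotient is the leading binary digit of \<open>y\<close>; it tells the two children
  of a vertex apart.\<close>

lemma coord_div_cases:
  assumes "(Suc n, y) \<in> coords"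
  shows "y div 2 ^ Suc n = 0 \<or> y div 2 ^ Suc n = 1"
proof -
  let ?D = "2 ^ Suc n :: int"
  have y: "0 \<le> y" "y < 2 * ?D" using assms by (auto simp: coords_def)
  show ?thesis
  proof (cases "y < ?D")
    case False
    then have "(y - ?D) div ?D = 0" using y by (intro div_pos_pos_trivial) auto
    moreover have "(y - ?D + ?D) div ?D = (y - ?D) div ?D + 1" by (rule div_add_self2) simp
    ultimately show ?thesis by simp
  qed (use y in auto)
qed

lemma coord_neighbours:
  assumes "(n, x) \<in> coords"
  shows "{b. ((n, x), b) \<in> coord_edges} = {parent (n, x), (Suc n, x), (Suc n, x + 2 ^ Suc n)}"
proof -
  have x: "0 \<le> x" "x < 2 ^ Suc n" using assms by (auto simp: coords_def)
  have ch: "b \<in> {parent (n, x), (Suc n, x), (Suc n, x + 2 ^ Suc n)}"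
    if b: "b \<in> coords" "parent b = (n, x)" for b
  proof (cases b rule: parent.cases)
    case (1 y)
    \<comment> \<open>On level \<open>0\<close> being the parent is a symmetric relation, so
      \<open>b\<close> is the parent of \<open>(n, x)\<close>.\<close>
    then show ?thesis using b by auto
  next
    case (2 l y)
    then have l: "l = n" and y: "y mod 2 ^ Suc n = x"
      using b by (auto simp: coords_def)
    have "y div 2 ^ Suc n = 0 \<or> y div 2 ^ Suc n = 1"
      using coord_div_cases[of n y] b(1) 2 l by simp
    moreover have "y = 2 ^ Suc n * (y div 2 ^ Suc n) + x" using y by (metis mult_div_mod_eq)
    ultimately show ?thesis using 2 l by auto
  qed
  have "(x + 2 ^ Suc n) mod 2 ^ Suc n = x" using x by (metis mod_add_self2 mod_pos_pos_trivial)
  then have "parent (Suc n, x) = (n, x)" "parent (Suc n, x + 2 ^ Suc n) = (n, x)"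
    using x by (simp_all del: power_Suc)
  moreover have "(Suc n, x) \<in> coords" "(Suc n, x + 2 ^ Suc n) \<in> coords"
    using x by (auto simp: coords_def)
  moreover have "((n, x), b) \<in> coord_edges \<longleftrightarrow> b \<in> coords \<and> (b = parent (n, x) \<or> parent b = (n, x))" for b
    using assms unfolding coord_edges_def by (metis (mono_tags, lifting) case_prodI case_prodD mem_Collect_eq)
  ultimately show ?thesis
    using parent_in_coords[OF assms] ch by blast
qed

text \<open>Each value is a pair of a vertex and its parent, since the children of a vertex are chosen
  among the neighbours different from the parent.\<close>

primrec tree_coord :: "('a \<times> 'a \<Rightarrow> int \<Rightarrow> 'a) \<Rightarrow> 'a \<times> 'a \<Rightarrow> nat \<Rightarrow> int \<Rightarrow> 'a \<times> 'a" where
  "tree_coord c e 0 x = (if x = 0 then e else prod.swap e)"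
| "tree_coord c e (Suc n) y =
     (let q = tree_coord c e n (y mod 2 ^ Suc n) in (c q (y div 2 ^ Suc n), fst q))"

text \<open>The two children are put in order for every pair of a vertex and its parent. Following
  these choices from an arbitrary edge gives a map that is bijective on neighbourhoods, hence an
  isomorphism.\<close>

lemma regular_tree_3_coordinates:
  assumes "regular_tree 3 V E"
  obtains f where "bij_betw f coords V"
    "\<And>a b. a \<in> coords \<Longrightarrow> b \<in> coords \<Longrightarrow> (f a, f b) \<in> E \<longleftrightarrow> (a, b) \<in> coord_edges"
proof -
  have tree: "graph_tree V E" and card: "\<And>v. v \<in> V \<Longrightarrow> card {w. (v, w) \<in> E} = 3"
    using assms by (auto simp: regular_tree_def)
  have EV: "E \<subseteq> V \<times> V" and symE: "sym E" and "V \<noteq> {}"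
    using tree by (auto simp: graph_tree_def simple_graph_def)
  obtain v where "v \<in> V" using \<open>V \<noteq> {}\<close> by blast
  have "{w. (v, w) \<in> E} \<noteq> {}" using card[OF \<open>v \<in> V\<close>] by (metis card.empty zero_neq_numeral)
  then obtain w where e: "(v, w) \<in> E" by blast
  \<comment> \<open>Here \<open>q\<close> is a pair of a vertex and its parent; \<open>c 0\<close>
    and \<open>c 1\<close> are the other two neighbours, labelled by the digit that
    \<open>tree_coord\<close> reads.\<close>
  have "\<exists>c :: int \<Rightarrow> 'a. {u. (fst q, u) \<in> E} = {snd q, c 0, c 1} \<and> c 0 \<noteq> c 1 \<and> c 0 \<noteq> snd q \<and> c 1 \<noteq> snd q"
    if "q \<in> E" for q
  proof -
    have "snd q \<in> {u. (fst q, u) \<in> E}" "fst q \<in> V" using that EV by auto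
    then have "card ({u. (fst q, u) \<in> E} - {snd q}) = 2" using card by simp
    then obtain s t where st: "{u. (fst q, u) \<in> E} - {snd q} = {s, t}" "s \<noteq> t"
      by (auto simp: card_2_iff)
    then have "{u. (fst q, u) \<in> E} = {snd q, s, t}" "s \<noteq> snd q" "t \<noteq> snd q"
      using \<open>snd q \<in> _\<close> by blast+
    with st(2) show ?thesis by (intro exI[of _ "\<lambda>i. if i = 0 then s else t"]) auto
  qed
  then obtain c where c: "\<And>q. q \<in> E \<Longrightarrow> {u. (fst q, u) \<in> E} = {snd q, c q (0::int), c q 1}"
    "\<And>q. q \<in> E \<Longrightarrow> c q 0 \<noteq> c q 1 \<and> c q 0 \<noteq> snd q \<and> c q 1 \<noteq> snd q"
    by metis
  define P where "P = (\<lambda>(n, x). tree_coord c (v, w) n x)"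
  define f where "f = fst \<circ> P"
  have PE: "P (n, x) \<in> E" if "(n, x) \<in> coords" for n x
    using that
  proof (induction n arbitrary: x)
    case 0
    then show ?case using e symE by (auto simp: P_def dest: symD)
  next
    case (Suc n)
    let ?q = "P (n, x mod 2 ^ Suc n)" and ?i = "x div 2 ^ Suc n"
    have q: "?q \<in> E" using parent_in_coords[OF Suc.prems] by (intro Suc.IH) simp
    have "?i = 0 \<or> ?i = 1" by (rule coord_div_cases[OF Suc.prems])
    then have "c ?q ?i \<in> {u. (fst ?q, u) \<in> E}" unfolding c(1)[OF q] by auto
    then show ?case using symE by (auto simp: P_def Let_def dest: symD)
  qed
  have Ppar: "snd (P a) = f (parent a)" if "a \<in> coords" for a
    using that by (cases a rule: parent.cases) (auto simp: P_def f_def coords_def Let_def)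
  have loc: "bij_betw f {b. (a, b) \<in> coord_edges} {u. (f a, u) \<in> E}" if a: "a \<in> coords" for a
  proof -
    obtain n x where nx: "a = (n, x)" by (cases a)
    have x: "0 \<le> x" "x < 2 ^ Suc n" using a nx by (auto simp: coords_def)
    have q: "P a \<in> E" using PE a nx by simp
    have "(x + 2 ^ Suc n) mod 2 ^ Suc n = x" "(x + 2 ^ Suc n) div 2 ^ Suc n = 1"
      using x by (simp_all del: power_Suc)
    then have ch: "f (Suc n, x) = c (P a) 0" "f (Suc n, x + 2 ^ Suc n) = c (P a) 1"
      using x by (simp_all add: f_def P_def nx Let_def del: power_Suc)
    have "f (parent a) = snd (P a)" "f a = fst (P a)" using Ppar[OF a] by (auto simp: f_def)
    then show ?thesis
      using coord_neighbours[of n x] a c[OF q] ch unfolding nx bij_betw_def by auto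
  qed
  have V: "f a \<in> V" if "a \<in> coords" for a
    using PE[of "fst a" "snd a"] that EV by (auto simp: f_def mem_Times_iff)
  have sub: "coord_edges \<subseteq> coords \<times> coords" and ne: "coords \<noteq> {}"
    by (auto simp: coord_edges_def coords_def intro!: exI[of _ 0])
  show thesis
    by (rule that; rule local_isomorphism_onto_tree[OF tree coord_edges_connected sub sym_coord_edges ne V loc])
qed

section \<open>The odometer and its action on coordinates\<close>

text \<open>Adds \<open>k\<close> in the lowest \<open>N\<close> binary digits, drops the carry and
  keeps the higher digits. Working on integers lets one formula be reduced to every level.\<close>

definition odometer :: "nat \<Rightarrow> int \<Rightarrow> int \<Rightarrow> int" where
  "odometer N k y = 2 ^ N * (y div 2 ^ N) + (y + k) mod 2 ^ N"

lemma odometer_add: "odometer N k (odometer N l y) = odometer N (k + l) y"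
proof -
  have "odometer N l y div 2 ^ N = y div 2 ^ N" by (simp add: odometer_def)
  moreover have "(odometer N l y + k) mod 2 ^ N = (y + (k + l)) mod 2 ^ N"
    unfolding odometer_def by (simp add: add.assoc mod_simps) (simp add: ac_simps)
  ultimately show ?thesis unfolding odometer_def[of N k] odometer_def[of N "k + l"] by simp
qed

lemma odometer_0: "odometer N 0 y = y"
  by (simp add: odometer_def)

lemma odometer_period: "odometer N (2 ^ N) y = y"
  by (simp add: odometer_def)

lemma odometer_cong_add:
  assumes "j \<le> N"
  shows "[odometer N k y = y + k] (mod 2 ^ j)"
proof -
  have "[odometer N k y = y + k] (mod 2 ^ N)" by (simp add: odometer_def cong_def)
  then show ?thesis by (rule cong_dvd_modulus) (simp add: assms le_imp_power_dvd)
qed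

text \<open>This makes the action respect parents. For \<open>j \<le> N\<close> the map is a
  translation modulo \<open>2 ^ j\<close>; for larger \<open>j\<close> a change of \<open>y\<close>
  by a multiple of \<open>2 ^ j\<close> leaves the lowest \<open>N\<close> digits alone and passes
  through unchanged.\<close>

lemma odometer_cong:
  assumes "[y = z] (mod 2 ^ j)"
  shows "[odometer N k y = odometer N k z] (mod 2 ^ j)"
proof (cases "j \<le> N")
  case True
  have "[y + k = z + k] (mod 2 ^ j)" using assms by (simp add: cong_add_rcancel)
  then show ?thesis using odometer_cong_add[OF True] by (meson cong_sym cong_trans)
next
  case False
  then obtain d where j: "j = N + d" using nat_le_iff_add by (metis nat_le_linear)
  obtain t where z: "z = y + 2 ^ N * (2 ^ d * t)"
    using assms unfolding cong_iff_lin j by (auto simp: power_add mult.assoc)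
  have "z + k = (y + k) + 2 ^ N * (2 ^ d * t)" by (simp add: z)
  then have "(z + k) mod 2 ^ N = (y + k) mod 2 ^ N" by (simp only: mod_mult_self2)
  moreover have "z div 2 ^ N = y div 2 ^ N + 2 ^ d * t" by (simp add: z)
  ultimately have "odometer N k z = odometer N k y + 2 ^ j * t"
    by (simp add: odometer_def j power_add algebra_simps)
  then show ?thesis by (auto simp: cong_iff_lin)
qed

definition rotate_coord :: "nat \<Rightarrow> int \<Rightarrow> nat \<times> int \<Rightarrow> nat \<times> int" where
  "rotate_coord N k = (\<lambda>(n, x). (n, odometer N k x mod 2 ^ Suc n))"

lemma rotate_coord_in_coords: "rotate_coord N k a \<in> coords"
  by (cases a) (simp add: rotate_coord_def coords_def)

lemma rotate_coord_add: "rotate_coord N k (rotate_coord N l a) = rotate_coord N (k + l) a"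
proof (cases a)
  case (Pair n x)
  have "[odometer N k (odometer N l x mod 2 ^ Suc n) = odometer N k (odometer N l x)] (mod 2 ^ Suc n)"
    by (rule odometer_cong) simp
  then show ?thesis by (simp add: Pair rotate_coord_def odometer_add cong_def)
qed

lemma rotate_coord_0: "a \<in> coords \<Longrightarrow> rotate_coord N 0 a = a"
  by (cases a) (auto simp: rotate_coord_def odometer_0 coords_def)

lemma rotate_coord_period: "a \<in> coords \<Longrightarrow> rotate_coord N (2 ^ N) a = a"
  by (cases a) (auto simp: rotate_coord_def odometer_period coords_def)

lemma rotate_coord_eq:
  "n < N \<Longrightarrow> rotate_coord N k (n, x) = (n, (x + k) mod 2 ^ Suc n)"
  using odometer_cong_add[of "Suc n" N k x] by (simp add: rotate_coord_def cong_def)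

lemma rotate_coord_parent:
  assumes "0 < N"
  shows "parent (rotate_coord N k a) = rotate_coord N k (parent a)"
proof (cases a rule: parent.cases)
  case (1 x)
  have "1 - (x + k) mod 2 = (1 - x + k) mod 2" by presburger
  then show ?thesis using assms by (simp add: 1 rotate_coord_eq)
next
  case (2 n y)
  have "[odometer N k (y mod 2 ^ Suc n) = odometer N k y] (mod 2 ^ Suc n)"
    by (rule odometer_cong) simp
  then show ?thesis by (simp add: 2 rotate_coord_def cong_def mod_mod_cancel)
qed

lemma rotate_coord_edges:
  assumes "0 < N" "(a, b) \<in> coord_edges"
  shows "(rotate_coord N k a, rotate_coord N k b) \<in> coord_edges"
  using assms by (auto simp: coord_edges_def rotate_coord_in_coords rotate_coord_parent)

section \<open>The automorphisms induced by the odometer\<close>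

lemma ball_2_memI:
  assumes "w \<in> V" "(v, w) \<in> E ^^ k" "k \<le> 2"
  shows "w \<in> graph_ball V E v 2"
proof -
  have "graph_dist E v w \<le> k" unfolding graph_dist_def by (rule Least_le[of _ k]) (rule assms)
  then show ?thesis using assms by (simp add: graph_ball_def)
qed

locale coordinatised_tree =
  fixes V :: "'a set" and E :: "('a \<times> 'a) set" and f :: "nat \<times> int \<Rightarrow> 'a"
  assumes bij: "bij_betw f coords V"
    and EV: "E \<subseteq> V \<times> V"
    and edges: "a \<in> coords \<Longrightarrow> b \<in> coords \<Longrightarrow> (f a, f b) \<in> E \<longleftrightarrow> (a, b) \<in> coord_edges"
begin

sublocale Aut: group "Aut_graph V E" by (rule group_Aut_graph)

lemma mem_V: "a \<in> coords \<Longrightarrow> f a \<in> V"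
  using bij by (auto simp: bij_betw_def)

lemma f_inject: "f a = f b \<longleftrightarrow> a = b" if "a \<in> coords" "b \<in> coords"
  using bij that by (auto simp: bij_betw_def inj_on_def)

lemma V_cases:
  assumes "v \<in> V"
  obtains a where "a \<in> coords" "v = f a"
  using bij assms by (auto simp: bij_betw_def)

text \<open>The integer \<open>k\<close> plays the role of an exponent of \<open>rot N 1\<close>.
  The restriction to \<open>V\<close> matches the representation of automorphisms in
  \<open>Aut_graph V E\<close>.\<close>

definition rot :: "nat \<Rightarrow> int \<Rightarrow> 'a \<Rightarrow> 'a" where
  "rot N k = (\<lambda>v\<in>V. f (rotate_coord N k (inv_into coords f v)))"

lemma rot_f: "a \<in> coords \<Longrightarrow> rot N k (f a) = f (rotate_coord N k a)"
  using bij by (simp add: rot_def mem_V bij_betw_def)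

lemma rot_add: "v \<in> V \<Longrightarrow> rot N k (rot N l v) = rot N (k + l) v"
  by (elim V_cases) (simp_all add: rot_f rotate_coord_in_coords rotate_coord_add)

lemma rot_0: "v \<in> V \<Longrightarrow> rot N 0 v = v"
  by (elim V_cases) (simp_all add: rot_f rotate_coord_0)

lemma rot_mem_V: "v \<in> V \<Longrightarrow> rot N k v \<in> V"
  by (elim V_cases) (simp_all add: rot_f rotate_coord_in_coords mem_V)

lemma rot_carrier:
  assumes "0 < N"
  shows "rot N k \<in> carrier (Aut_graph V E)"
proof -
  have "bij_betw (rot N k) V V"
    by (rule bij_betw_byWitness[of _ "rot N (- k)"]) (auto simp: rot_add rot_0 rot_mem_V)
  then have "rot N k \<in> Bij V" by (simp add: Bij_def rot_def)
  moreover have hom: "(rot N l v, rot N l w) \<in> E" if "(v, w) \<in> E" "v \<in> V" "w \<in> V" for l v w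
    using that assms
    by (auto elim!: V_cases simp: rot_f edges rotate_coord_in_coords rotate_coord_edges)
  have "(rot N k v, rot N k w) \<in> E \<longleftrightarrow> (v, w) \<in> E" if "v \<in> V" "w \<in> V" for v w
    using hom[of v w k] hom[of "rot N k v" "rot N k w" "- k"] that by (auto simp: rot_add rot_0 rot_mem_V)
  ultimately show ?thesis by (simp add: Aut_graph_def graph_auts_def)
qed

lemma Aut_mult:
  assumes "g \<in> carrier (Aut_graph V E)" "h \<in> carrier (Aut_graph V E)"
  shows "g \<otimes>\<^bsub>Aut_graph V E\<^esub> h = compose V g h"
  using assms by (simp add: Aut_graph_def graph_auts_def BijGroup_def)

lemma Aut_one: "\<one>\<^bsub>Aut_graph V E\<^esub> = (\<lambda>v\<in>V. v)"
  by (simp add: Aut_graph_def BijGroup_def)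

lemma rot_mult:
  assumes "0 < N"
  shows "rot N k \<otimes>\<^bsub>Aut_graph V E\<^esub> rot N l = rot N (k + l)"
proof -
  have "compose V (rot N k) (rot N l) = rot N (k + l)"
    by (rule ext) (auto simp: compose_def rot_add, simp add: rot_def)
  then show ?thesis using assms by (simp add: Aut_mult rot_carrier)
qed

lemma rot_one: "rot N 0 = \<one>\<^bsub>Aut_graph V E\<^esub>"
  unfolding Aut_one by (rule ext) (auto simp: rot_0, simp add: rot_def)

lemma rot_period: "rot N (2 ^ N) = \<one>\<^bsub>Aut_graph V E\<^esub>"
proof (rule ext)
  fix v
  show "rot N (2 ^ N) v = \<one>\<^bsub>Aut_graph V E\<^esub> v"
  proof (cases "v \<in> V")
    case True
    then show ?thesis unfolding Aut_one
      by (auto elim!: V_cases simp: rot_f rotate_coord_period mem_V)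
  qed (simp add: Aut_one rot_def)
qed

lemma rot_pow:
  assumes "0 < N"
  shows "rot N 1 [^]\<^bsub>Aut_graph V E\<^esub> i = rot N (int i)"
  by (induction i) (simp_all add: rot_one rot_mult[OF assms] add.commute)

lemma generate_rot:
  assumes "0 < N" "g \<in> generate (Aut_graph V E) {rot N 1}"
  shows "\<exists>k. g = rot N k"
  using assms(2)
proof induction
  case one
  show ?case by (metis rot_one)
next
  case (incl h)
  then show ?case by blast
next
  case (inv h)
  have "inv\<^bsub>Aut_graph V E\<^esub> (rot N 1) = rot N (- 1)"
    by (rule Aut.inv_equality) (simp_all add: assms(1) rot_mult rot_one rot_carrier)
  then show ?case using inv by blast
next
  case (eng h1 h2)
  then show ?case using rot_mult[OF assms(1)] by metis
qed

lemma Aut_pow_apply: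
  assumes h: "h \<in> carrier (Aut_graph V E)" and "v \<in> V"
  shows "(h [^]\<^bsub>Aut_graph V E\<^esub> i) v = (h ^^ i) v"
  using \<open>v \<in> V\<close>
proof (induction i arbitrary: v)
  case 0
  then show ?case by (simp add: Aut_one)
next
  case (Suc i)
  have "h v \<in> V" using h Suc.prems Bij_imp_funcset by (fastforce simp: Aut_graph_def graph_auts_def)
  then show ?case using Suc h
    by (simp add: Aut_mult compose_eq funpow_swap1 del: funpow.simps(2)) (simp add: funpow_swap1)
qed

text \<open>Infinite order is coded as \<open>0\<close>; here the order divides
  \<open>2 ^ N\<close>.\<close>

lemma rot_ord:
  assumes "0 < N"
  shows "Aut.ord (rot N 1) \<noteq> 0"
proof -
  have "rot N 1 [^]\<^bsub>Aut_graph V E\<^esub> (2 ^ N :: nat) = \<one>\<^bsub>Aut_graph V E\<^esub>"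
    using rot_pow[OF assms, of "2 ^ N"] rot_period by simp
  then have "Aut.ord (rot N 1) dvd 2 ^ N" using Aut.pow_eq_id[OF rot_carrier[OF assms]] by blast
  then show ?thesis by (metis dvd_0_left_iff power_eq_0_iff zero_neq_numeral)
qed

lemma rot_edge_inversion:
  assumes "0 < N"
  shows "edge_inversion V E (rot N 1)"
proof -
  have "(0, 0) \<in> coords" "(0, 1) \<in> coords" "((0, 0), (0, 1)) \<in> coord_edges"
    by (auto simp: coords_def coord_edges_def)
  then show ?thesis unfolding edge_inversion_def using assms
    by (auto intro!: rot_carrier bexI[of _ "(f (0, 0), f (0, 1))"] simp: rot_f edges rotate_coord_eq)
qed

section \<open>Orders of inversions in the closure\<close>

text \<open>\<open>K a\<close> is the exponent of a power of \<open>rot N 1\<close> that agrees with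
  \<open>h\<close> on the ball of radius \<open>2\<close> around \<open>f a\<close>. Points of this
  ball are reached by two steps, each possibly trivial, so that no distance has to be
  computed.\<close>

lemma P_closure_exponents:
  assumes "0 < N" "h \<in> P_closure V E 2 (generate (Aut_graph V E) {rot N 1})"
  obtains K where "\<And>a b c. a \<in> coords \<Longrightarrow> (a, b) \<in> coord_edges\<^sup>= \<Longrightarrow> (b, c) \<in> coord_edges\<^sup>= \<Longrightarrow>
    h (f c) = f (rotate_coord N (K a) c)"
proof -
  have "\<exists>k. \<forall>b c. (a, b) \<in> coord_edges\<^sup>= \<longrightarrow> (b, c) \<in> coord_edges\<^sup>= \<longrightarrow> h (f c) = f (rotate_coord N k c)"
    if a: "a \<in> coords" for a
  proof -
    obtain g where "g \<in> generate (Aut_graph V E) {rot N 1}"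
      and g: "restrict h (graph_ball V E (f a) 2) = restrict g (graph_ball V E (f a) 2)"
      using assms(2) mem_V[OF a] by (auto simp: P_closure_def)
    then obtain k where k: "g = rot N k" using generate_rot[OF assms(1)] by blast
    have "h (f c) = f (rotate_coord N k c)"
      if b: "(a, b) \<in> coord_edges\<^sup>=" and c: "(b, c) \<in> coord_edges\<^sup>=" for b c
    proof -
      have bC: "b \<in> coords" "c \<in> coords" using a b c by (auto simp: coord_edges_def)
      have ab: "a = b \<or> (f a, f b) \<in> E" and bc: "b = c \<or> (f b, f c) \<in> E"
        using a b c bC edges by auto
      have "\<exists>n\<le>2. (f a, f c) \<in> E ^^ n"
      proof -
        have "(f a, f c) \<in> E ^^ 0 \<or> (f a, f c) \<in> E ^^ 1 \<or> (f a, f c) \<in> E ^^ 2"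
          using ab bc by (auto simp: numeral_2_eq_2)
        then show ?thesis by (metis le_refl one_le_numeral zero_le)
      qed
      then have "f c \<in> graph_ball V E (f a) 2" using ball_2_memI mem_V bC by metis
      then have "h (f c) = rot N k (f c)" using g k by (metis restrict_apply')
      then show ?thesis using bC by (simp add: rot_f)
    qed
    then show ?thesis by blast
  qed
  then obtain K where "\<And>a. a \<in> coords \<Longrightarrow> \<forall>b c. (a, b) \<in> coord_edges\<^sup>= \<longrightarrow> (b, c) \<in> coord_edges\<^sup>= \<longrightarrow>
      h (f c) = f (rotate_coord N (K a) c)" by metis
  then show thesis by (intro that) blast
qed

text \<open>The local exponents satisfy the hypotheses of \<open>shift_at_period\<close>, applied to
  a vertex of level \<open>m\<close>. They are compared on levels up to \<open>m + 1\<close>, and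
  \<open>m + 2\<close> makes the generator a shift on all of these. Infinite order is covered
  because it is coded as \<open>0\<close>.\<close>

lemma P_closure_inversion_ord:
  assumes h: "h \<in> P_closure V E 2 (generate (Aut_graph V E) {rot (m + 2) 1})"
    and inv: "edge_inversion V E h"
  shows "2 ^ Suc m dvd Aut.ord h"
proof -
  let ?N = "m + 2"
  obtain K where K: "\<And>a b c. a \<in> coords \<Longrightarrow> (a, b) \<in> coord_edges\<^sup>= \<Longrightarrow> (b, c) \<in> coord_edges\<^sup>= \<Longrightarrow>
    h (f c) = f (rotate_coord ?N (K a) c)"
    using P_closure_exponents[OF _ h] by auto
  define k where "k = (\<lambda>n x. K (n, x))"
  \<comment> \<open>If \<open>(j, z)\<close> lies in both balls, both exponents compute its image
    under \<open>h\<close>; on a level \<open>j < ?N\<close> this is a congruence modulo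
    \<open>2 ^ Suc j\<close>.\<close>
  have agree: "[k n x = k l y] (mod 2 ^ Suc j)"
    if "j < ?N" "(n, x) \<in> coords" "(l, y) \<in> coords"
      "((n, x), b) \<in> coord_edges\<^sup>=" "(b, (j, z)) \<in> coord_edges\<^sup>="
      "((l, y), c) \<in> coord_edges\<^sup>=" "(c, (j, z)) \<in> coord_edges\<^sup>=" for n x l y j z b c
  proof -
    have "f (rotate_coord ?N (k n x) (j, z)) = f (rotate_coord ?N (k l y) (j, z))"
      using K that(2-) unfolding k_def by metis
    then have "rotate_coord ?N (k n x) (j, z) = rotate_coord ?N (k l y) (j, z)"
      by (simp only: f_inject rotate_coord_in_coords)
    then have "(z + k n x) mod 2 ^ Suc j = (z + k l y) mod 2 ^ Suc j"
      using that(1) by (simp add: rotate_coord_eq)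
    then show ?thesis by (metis cong_def cong_add_lcancel)
  qed
  have C0: "(0, 0) \<in> coords" "(0, 1) \<in> coords" by (auto simp: coords_def)
  \<comment> \<open>The vertex \<open>(1, 0)\<close> is a child of \<open>(0, 0)\<close> and two
    steps from \<open>(0, 1)\<close>, so it lies in both balls.\<close>
  have "[k 0 1 = k 0 0] (mod 2 ^ Suc 1)"
    by (rule agree[of 1 _ _ _ _ "(0, 0)" 0 "(0, 0)"]) (auto simp: coords_def coord_edges_def)
  then have base: "[k 0 1 = k 0 0] (mod 4)" by simp
  have step: "[k (Suc n) y = k n (y mod 2 ^ Suc n)] (mod 2 ^ (n + 3))"
    if "n < m" "y \<in> {0..<2 ^ Suc (Suc n)}" for n y
  proof -
    have y: "(Suc n, y) \<in> coords" using that by (simp add: coords_def)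
    have ch: "(Suc (Suc n), y) \<in> coords" using that by (auto simp: coords_def)
    have "parent (Suc (Suc n), y) = (Suc n, y)" using that by auto
    then have e: "((Suc n, y), (Suc (Suc n), y)) \<in> coord_edges"
      using y ch by (auto simp: coord_edges_def)
    have e': "((n, y mod 2 ^ Suc n), (Suc n, y)) \<in> coord_edges"
      using y parent_in_coords[OF y] by (auto simp: coord_edges_def)
    \<comment> \<open>The child \<open>(Suc (Suc n), y)\<close> of \<open>(Suc n, y)\<close> lies in
      the balls around \<open>(Suc n, y)\<close> and around its parent; its level gives the
      modulus.\<close>
    have "[k (Suc n) y = k n (y mod 2 ^ Suc n)] (mod 2 ^ Suc (Suc (Suc n)))"
      by (rule agree[where b = "(Suc n, y)" and c = "(Suc n, y)" and z = y])
        (use that(1) y parent_in_coords[OF y] e e' in auto)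
    then show ?thesis by (simp only: add_Suc_right numeral_3_eq_3 add_0_right)
  qed
  have self: "h (f (n, x)) = f (n, shift_at k n x)" if "(n, x) \<in> coords" "n \<le> m" for n x
    using K[of "(n, x)" "(n, x)" "(n, x)"] that by (simp add: rotate_coord_eq shift_at_def k_def)
  \<comment> \<open>Being locally a rotation, \<open>h\<close> preserves levels, and only the root
    edge has both ends on one level. Swapping these ends is a shift by an odd amount.\<close>
  have odd: "odd (k 0 0)"
  proof -
    obtain v w where vw: "(v, w) \<in> E" "h v = w" "h w = v" using inv by (auto simp: edge_inversion_def)
    have "v \<in> V" "w \<in> V" using vw(1) EV by auto
    then obtain a b where ab: "a \<in> coords" "v = f a" "b \<in> coords" "w = f b"
      using V_cases by metis
    have "(a, b) \<in> coord_edges" using vw(1) ab edges by simp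
    moreover have "b = rotate_coord ?N (K a) a"
      using K[of a a a] vw(2) ab by (simp add: f_inject rotate_coord_in_coords)
    then have "fst a = fst b" by (simp add: rotate_coord_def split: prod.split)
    ultimately have "fst a = 0 \<and> b = parent a \<or> fst b = 0 \<and> a = parent b"
      by (cases a rule: parent.cases; cases b rule: parent.cases) (auto simp: coord_edges_def)
    then have "a = (0, 0) \<and> b = (0, 1) \<or> a = (0, 1) \<and> b = (0, 0)"
      using ab(1,3) by (cases a rule: parent.cases; cases b rule: parent.cases) (auto simp: coords_def)
    then have "h (f (0, 0)) = f (0, 1)" using vw ab by auto
    then have "shift_at k 0 0 = 1"
      using self[of 0 0] C0 shift_at_funpow_range[where x = 0 and n = 0 and K = k and i = 1]
      by (simp add: f_inject coords_def)
    then show ?thesis by (auto simp: shift_at_def)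
  qed
  let ?i = "Aut.ord h"
  have hC: "h \<in> carrier (Aut_graph V E)" using inv by (simp add: edge_inversion_def)
  have iter: "(h ^^ i) (f (m, 0)) = f (m, (shift_at k m ^^ i) 0)" for i
  proof (induction i)
    case (Suc i)
    have "(m, (shift_at k m ^^ i) 0) \<in> coords"
      using shift_at_funpow_range[where x = 0 and n = m and K = k and i = i] by (simp add: coords_def)
    then show ?case using Suc self by simp
  qed simp
  have 0: "(m, 0) \<in> coords" by (simp add: coords_def)
  have "(h ^^ ?i) (f (m, 0)) = f (m, 0)"
    using Aut.pow_ord_eq_1[OF hC] Aut_pow_apply[OF hC mem_V[OF 0], of ?i] mem_V[OF 0]
    by (simp add: Aut_one)
  then have "(shift_at k m ^^ ?i) 0 = 0"
    using iter[of ?i] 0 shift_at_funpow_range[where x = 0 and n = m and K = k and i = ?i]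
    by (simp add: f_inject coords_def)
  then show ?thesis
    using shift_at_period[of k m m 0 ?i, OF odd base step] by simp
qed

end

theorem corollary3p7:
  fixes V :: "'a set" and E :: "('a \<times> 'a) set"
  assumes "regular_tree 3 V E"
  shows "\<forall>m::nat. \<exists>g\<in>carrier (Aut_graph V E).
    (\<exists>h\<in>P_closure V E 2 (generate (Aut_graph V E) {g}).
       edge_inversion V E h \<and> group.ord (Aut_graph V E) h \<noteq> 0) \<and>
    \<not> (\<exists>h\<in>P_closure V E 2 (generate (Aut_graph V E) {g}).
       edge_inversion V E h \<and> 0 < group.ord (Aut_graph V E) h \<and> group.ord (Aut_graph V E) h < m)"
proof
  fix m :: nat
  obtain f where "bij_betw f coords V"
    "\<And>a b. a \<in> coords \<Longrightarrow> b \<in> coords \<Longrightarrow> (f a, f b) \<in> E \<longleftrightarrow> (a, b) \<in> coord_edges"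
    using regular_tree_3_coordinates[OF assms] by blast
  then interpret coordinatised_tree V E f
    using assms by unfold_locales (auto simp: regular_tree_def graph_tree_def simple_graph_def)
  \<comment> \<open>This \<open>?g\<close> is itself an inversion of finite order, and the bound
    \<open>2 ^ Suc m\<close> that it yields for finite orders of inversions exceeds
    \<open>m\<close>.\<close>
  let ?G = "Aut_graph V E" and ?g = "rot (m + 2) 1"
  have g: "?g \<in> carrier ?G" by (rule rot_carrier) simp
  have "?g \<in> generate ?G {?g}" by (simp add: generate.incl)
  then have cl: "?g \<in> P_closure V E 2 (generate ?G {?g})"
    using g by (auto simp: P_closure_def)
  have "\<not> group.ord ?G h < m"
    if "h \<in> P_closure V E 2 (generate ?G {?g})" "edge_inversion V E h" "0 < group.ord ?G h" for h
  proof -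
    have "m < 2 ^ Suc m" by (metis less_exp lessI less_trans)
    also have "\<dots> \<le> group.ord ?G h"
      by (rule dvd_imp_le[OF P_closure_inversion_ord[OF that(1,2)] that(3)])
    finally show ?thesis by simp
  qed
  then show "\<exists>g\<in>carrier ?G. (\<exists>h\<in>P_closure V E 2 (generate ?G {g}).
       edge_inversion V E h \<and> group.ord ?G h \<noteq> 0) \<and>
    \<not> (\<exists>h\<in>P_closure V E 2 (generate ?G {g}).
       edge_inversion V E h \<and> 0 < group.ord ?G h \<and> group.ord ?G h < m)"
    using g cl rot_edge_inversion[of "m + 2"] rot_ord[of "m + 2"] by (intro bexI[of _ ?g]) auto
qed

end
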